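(* Let $\Gamma$ be a distance-regular graph of valency $k$ and minimum eigenvalue $\theta_d$ which is geometric with respect to a set $\mathcal{K}$ of Delsarte cliques, and let $\Gamma'$ be the clique graph of $\Gamma$ with respect to $\mathcal{K}$. If $C$ is a completely regular code in $\Gamma$ with $\theta_d\in Spec(C)$, then $C'=\{K\in\mathcal{K}: K\cap C\neq\emptyset\}$ is a completely regular code in $\Gamma'$ and $Spec(C')=\{\theta-\theta_d-1+\frac{k}{\theta_d}: \theta\in Spec(C),\ \theta\neq\theta_d\}$.
   Context: A distance-regular graph of valency $k$ and diameter $d$ has distinct eigenvalues $\theta_0=k>\dots>\theta_d$ (eigenvalues of its adjacency matrix). A Delsarte clique is a clique of size $1-\frac{k}{\theta_d}$. $\Gamma$ is geometric with respect to a set $\mathcal{K}$ of Delsarte cliques if every edge lies in exactly one clique of $\mathcal{K}$. The clique graph $\Gamma'$ has vertex set $\mathcal{K}$, with $K,K'$ adjacent iff $|K\cap K'|=1$. For a code (vertex subset) $C$ of a regular graph, $C_i$ is the set of vertices at distance exactly $i$ from $C$, and the covering radius $\rho$ is the largest $i$ with $C_i\neq\emptyset$. $C$ is completely regular if there are numbers $\alpha_i,\beta_i,\gamma_i$ such that each vertex of $C_i$ has exactly $\alpha_i,\beta_i,\gamma_i$ neighbours in $C_i,C_{i+1},C_{i-1}$ respectively. $Spec(C)$ is the set of eigenvalues of the $(\rho+1)\times(\rho+1)$ tridiagonal intersection matrix with diagonal $\alpha_0,\dots,\alpha_\rho$, superdiagonal $\beta_0,\dots,\beta_{\rho-1}$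 and subdiagonal $\gamma_1,\dots,\gamma_\rho$. *)

theory Defs
  imports
    "Graph_Theory.Graph_Theory"
    "Jordan_Normal_Form.Spectral_Radius"
begin

text \<open>Finite simple graphs are those of the locale \<^locale>\<open>pair_graph\<close>: every edge is
  represented by its two opposite arcs in \<^const>\<open>parcs\<close>.\<close>

definition nbrs :: "'a pair_pre_digraph \<Rightarrow> 'a \<Rightarrow> 'a set" where
  "nbrs G x = {y. (x, y) \<in> parcs G}"

definition regular_graph :: "'a pair_pre_digraph \<Rightarrow> nat \<Rightarrow> bool" where
  "regular_graph G k \<longleftrightarrow> pair_graph G \<and> (\<forall>x\<in>pverts G. card (nbrs G x) = k)"

definition gdist :: "'a pair_pre_digraph \<Rightarrow> 'a \<Rightarrow> 'a \<Rightarrow> ereal" where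
  "gdist G x y = wf_digraph.\<mu> (with_proj G) (\<lambda>_. 1) x y"

text \<open>The numbers \<open>b i\<close>, \<open>c i\<close> are the usual intersection numbers. For \<open>i = 0\<close> the second
  set is empty, as no vertex is at distance \<open>-1\<close>.\<close>

definition distance_regular :: "'a pair_pre_digraph \<Rightarrow> bool" where
  "distance_regular G \<longleftrightarrow>
     pair_graph G \<and> Digraph_Component.connected (with_proj G) \<and>
     (\<exists>b c :: nat \<Rightarrow> nat. \<forall>i. \<forall>x\<in>pverts G. \<forall>y\<in>pverts G. gdist G x y = ereal (real i) \<longrightarrow>
        card {z \<in> nbrs G y. gdist G x z = ereal (real i + 1)} = b i \<and>
        card {z \<in> nbrs G y. gdist G x z = ereal (real i - 1)} = c i)"

text \<open>The adjacency matrix is taken with respect to some enumeration of the vertices; another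
  enumeration conjugates it by a permutation matrix and so leaves the spectrum unchanged. All
  eigenvalues of this symmetric matrix are real, so nothing is lost by working over the reals.\<close>

definition vertex_list :: "'a pair_pre_digraph \<Rightarrow> 'a list" where
  "vertex_list G = (SOME xs. distinct xs \<and> set xs = pverts G)"

definition adjacency_mat :: "'a pair_pre_digraph \<Rightarrow> real mat" where
  "adjacency_mat G = mat (card (pverts G)) (card (pverts G))
     (\<lambda>(i, j). if (vertex_list G ! i, vertex_list G ! j) \<in> parcs G then 1 else 0)"

definition min_eigenvalue :: "'a pair_pre_digraph \<Rightarrow> real" where
  "min_eigenvalue G = Min (spectrum (adjacency_mat G))"

definition clique :: "'a pair_pre_digraph \<Rightarrow> 'a set \<Rightarrow> bool" where
  "clique G K \<longleftrightarrow> K \<subseteq> pverts G \<and> (\<forall>x\<in>K. \<forall>y\<in>K. x \<noteq> y \<longrightarrow> (x, y) \<in> parcs G)"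

definition delsarte_clique :: "'a pair_pre_digraph \<Rightarrow> nat \<Rightarrow> 'a set \<Rightarrow> bool" where
  "delsarte_clique G k K \<longleftrightarrow> clique G K \<and> real (card K) = 1 - real k / min_eigenvalue G"

definition geometric :: "'a pair_pre_digraph \<Rightarrow> nat \<Rightarrow> 'a set set \<Rightarrow> bool" where
  "geometric G k \<K> \<longleftrightarrow> (\<forall>K\<in>\<K>. delsarte_clique G k K) \<and>
     (\<forall>(x, y)\<in>parcs G. \<exists>!K. K \<in> \<K> \<and> x \<in> K \<and> y \<in> K)"

definition clique_graph :: "'a set set \<Rightarrow> 'a set pair_pre_digraph" where
  "clique_graph \<K> = \<lparr> pverts = \<K>,
     parcs = {(K, L). K \<in> \<K> \<and> L \<in> \<K> \<and> K \<noteq> L \<and> card (K \<inter> L) = 1} \<rparr>"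

text \<open>The sets \<open>C_i\<close> of the distance partition.\<close>

definition layer :: "'a pair_pre_digraph \<Rightarrow> 'a set \<Rightarrow> nat \<Rightarrow> 'a set" where
  "layer G C i = {x \<in> pverts G. (INF c\<in>C. gdist G c x) = ereal (real i)}"

definition covering_radius :: "'a pair_pre_digraph \<Rightarrow> 'a set \<Rightarrow> nat" where
  "covering_radius G C = Max {i. layer G C i \<noteq> {}}"

definition completely_regular :: "'a pair_pre_digraph \<Rightarrow> 'a set \<Rightarrow> bool" where
  "completely_regular G C \<longleftrightarrow>
     (\<exists>k. regular_graph G k) \<and> C \<subseteq> pverts G \<and> C \<noteq> {} \<and>
     (\<exists>\<alpha> \<beta> \<gamma> :: nat \<Rightarrow> nat. \<forall>i\<le>covering_radius G C. \<forall>x\<in>layer G C i.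
        card (nbrs G x \<inter> layer G C i) = \<alpha> i \<and>
        card (nbrs G x \<inter> layer G C (i + 1)) = \<beta> i \<and>
        (i > 0 \<longrightarrow> card (nbrs G x \<inter> layer G C (i - 1)) = \<gamma> i))"

text \<open>For a completely regular code the descriptions below are proper: each of the layers
  \<open>0, \<dots>, \<rho>\<close> is nonempty, so \<open>\<alpha>\<^sub>i\<close>, \<open>\<beta>\<^sub>i\<close>, \<open>\<gamma>\<^sub>i\<close>, which are \<open>int_num G C i j\<close>
  for \<open>j = i\<close>, \<open>i + 1\<close>, \<open>i - 1\<close>, are uniquely determined.\<close>

definition int_num :: "'a pair_pre_digraph \<Rightarrow> 'a set \<Rightarrow> nat \<Rightarrow> nat \<Rightarrow> nat" where
  "int_num G C i j = (THE m. \<forall>x\<in>layer G C i. card (nbrs G x \<inter> layer G C j) = m)"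

definition intersection_mat :: "'a pair_pre_digraph \<Rightarrow> 'a set \<Rightarrow> real mat" where
  "intersection_mat G C = mat (covering_radius G C + 1) (covering_radius G C + 1)
     (\<lambda>(i, j). if j = i \<or> j = i + 1 \<or> i = j + 1 then real (int_num G C i j) else 0)"

text \<open>The real eigenvalues are all eigenvalues: for a completely regular code the off-diagonal
  products \<open>\<beta>\<^sub>i \<gamma>\<^sub>i\<^sub>+\<^sub>1\<close> are positive, so the matrix is similar to a symmetric one.\<close>

definition Spec :: "'a pair_pre_digraph \<Rightarrow> 'a set \<Rightarrow> real set" where
  "Spec G C = spectrum (intersection_mat G C)"

end

theory Submission
  imports Defs
begin

text \<open>Let \<open>N\<close> be the incidence matrix of vertices and cliques of \<open>\<K>\<close>. Each vertex lies in
  \<open>r = - \<theta>\<^sub>d\<close> cliques and each clique has \<open>n = 1 - k / \<theta>\<^sub>d\<close> vertices, so \<open>N N\<^sup>T = A + r I\<close> and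
  \<open>N\<^sup>T N = A' + n I\<close> for the adjacency matrices \<open>A\<close>, \<open>A'\<close> of the two graphs. An eigenvector \<open>u\<close>
  of the intersection matrix of \<open>C\<close> for \<open>\<theta>\<^sub>d\<close> lifts to a function on the vertices, constant on the
  layers of \<open>C\<close>, in the kernel of \<open>N N\<^sup>T\<close> and hence of \<open>N\<^sup>T\<close>: it sums to zero over every clique.
  An edge between consecutive layers lies in a clique meeting just these two, so if \<open>u\<close> vanished
  on one layer it would vanish on all. Therefore every clique meets exactly two consecutive layers
  \<open>C\<^sub>i\<close>, \<open>C\<^sub>i\<^sub>+\<^sub>1\<close>, in numbers determined by \<open>u\<close>, and the cliques with given \<open>i\<close> form the \<open>i\<close>-th
  layer of \<open>C'\<close>. The maps \<open>N\<^sup>T\<close> and \<open>N\<close> then carry layer-constant eigenfunctions to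
  layer-constant eigenfunctions; \<open>N\<close> is injective on those of the cliques, which excludes the
  eigenvalue \<open>0\<close> of \<open>N\<^sup>T N\<close>.\<close>

section \<open>Functions and sums depending only on a level\<close>

text \<open>Turns dependence on \<open>F\<close> alone into an explicit function of
  \<open>F\<close>, evaluated at a chosen preimage. Quantities constant on layers become functions
  of the level in this way.\<close>

lemma factor_through:
  assumes "\<And>x y. x \<in> A \<Longrightarrow> y \<in> A \<Longrightarrow> F x = F y \<Longrightarrow> f x = f y"
  shows "\<exists>\<phi>. \<forall>x\<in>A. f x = \<phi> (F x)"
proof (intro exI ballI)
  fix x assume "x \<in> A"
  then show "f x = f (inv_into A F (F x))"
    by (intro assms) (simp_all add: inv_into_into f_inv_into_f)
qed

lemma sum_by_value:
  fixes \<phi> :: "'b \<Rightarrow> real"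
  assumes "finite A" "finite J" "F ` A \<subseteq> J"
  shows "(\<Sum>x\<in>A. \<phi> (F x)) = (\<Sum>j\<in>J. real (card {x \<in> A. F x = j}) * \<phi> j)"
proof -
  have "(\<Sum>x\<in>A. \<phi> (F x)) = (\<Sum>j\<in>J. \<Sum>x\<in>{x \<in> A. F x = j}. \<phi> (F x))"
    using assms by (intro sum.group[symmetric]) auto
  then show ?thesis by simp
qed

lemma sum_indicator_value:
  assumes "finite A"
  shows "(\<Sum>x\<in>A. if F x = j then 1 else 0) = real (card {x \<in> A. F x = j})"
  using assms by (simp add: sum.If_cases Int_def)

subsection \<open>Distance layers and equitable partitions\<close>

text \<open>The local conditions characterize \<open>t\<close> as the distance from
  \<open>C\<close>, so a distance partition can be certified without computing infima; the locale
  serves for both graphs.\<close>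

locale distance_layering = pair_graph G for G :: "'a pair_pre_digraph" +
  fixes C :: "'a set" and t :: "'a \<Rightarrow> nat"
  assumes code_subset: "C \<subseteq> pverts G" and code_nonempty: "C \<noteq> {}"
    and level_zero: "x \<in> pverts G \<Longrightarrow> t x = 0 \<longleftrightarrow> x \<in> C"
    and level_step: "(x, y) \<in> parcs G \<Longrightarrow> t y \<le> t x + 1"
    and level_pred: "x \<in> pverts G \<Longrightarrow> t x > 0 \<Longrightarrow> \<exists>y. (y, x) \<in> parcs G \<and> t x = t y + 1"
begin

lemma level_le_length: "awalk c p x \<Longrightarrow> t x \<le> t c + length p"
proof (induction p arbitrary: c)
  case Nil
  then show ?case by (auto simp: awalk_Nil_iff)
next
  case (Cons e p)
  then have "awalk (snd e) p x" "fst e = c" "e \<in> parcs G"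
    by (auto simp: awalk_Cons_iff)
  with Cons.IH[of "snd e"] level_step[of "fst e" "snd e"] show ?case by auto
qed

lemma level_attained: "x \<in> pverts G \<Longrightarrow> \<exists>c\<in>C. \<exists>p. awalk c p x \<and> length p = t x"
proof (induction "t x" arbitrary: x)
  case 0
  then show ?case using level_zero[of x] by (auto simp: awalk_Nil_iff intro!: bexI[of _ x])
next
  case (Suc i)
  obtain y where y: "(y, x) \<in> parcs G" "t x = t y + 1"
    using level_pred[of x] Suc by auto
  have yV: "y \<in> pverts G" using y in_arcsD1 by blast
  obtain c p where p: "c \<in> C" "awalk c p y" "length p = t y"
    using Suc.hyps(1)[of y] Suc.hyps(2) y yV by auto
  have "awalk y [(y, x)] x"
    using y yV Suc.prems by (auto simp: awalk_Cons_iff awalk_Nil_iff)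
  with p y show ?case by (intro bexI[of _ c] exI[of _ "p @ [(y, x)]"]) auto
qed

text \<open>The level bounds the length of every walk from \<open>C\<close> from below, and
  following predecessors back to \<open>C\<close> gives a walk attaining it.\<close>

lemma INF_gdist_eq_level:
  assumes "x \<in> pverts G"
  shows "(INF c\<in>C. gdist G c x) = ereal (real (t x))"
proof (rule antisym)
  have cost: "awalk_cost (\<lambda>_. 1) p = real (length p)" for p :: "('a \<times> 'a) list"
    by (induction p) (auto simp: awalk_cost_def)
  obtain c p where p: "c \<in> C" "awalk c p x" "length p = t x"
    using level_attained[OF assms] by blast
  have "gdist G c x \<le> ereal (awalk_cost (\<lambda>_. 1) p)"
    unfolding gdist_def by (rule min_cost_le_walk_cost[OF p(2)])
  then show "(INF c\<in>C. gdist G c x) \<le> ereal (real (t x))"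
    using p(1,3) by (auto intro: INF_lower2 simp: cost)
  show "ereal (real (t x)) \<le> (INF c\<in>C. gdist G c x)"
  proof (rule INF_greatest)
    fix c assume c: "c \<in> C"
    show "ereal (real (t x)) \<le> gdist G c x"
      unfolding gdist_def \<mu>_def
    proof (rule INF_greatest)
      fix p assume "p \<in> {p. awalk c p x}"
      then have "t x \<le> length p"
        using level_le_length[of c p x] level_zero[of c] c code_subset by auto
      then show "ereal (real (t x)) \<le> ereal (awalk_cost (\<lambda>_. 1) p)"
        by (simp add: cost)
    qed
  qed
qed

lemma layer_eq: "layer G C i = {x \<in> pverts G. t x = i}"
  unfolding layer_def using INF_gdist_eq_level by auto

lemma nbrs_subset: "nbrs G x \<subseteq> pverts G"
  unfolding nbrs_def using in_arcsD2 by blast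

lemma finite_nbrs: "finite (nbrs G x)"
  using nbrs_subset pair_finite_verts finite_subset by blast

lemma level_down: "x \<in> pverts G \<Longrightarrow> j \<le> t x \<Longrightarrow> \<exists>y\<in>pverts G. t y = j"
proof (induction "t x" arbitrary: x)
  case 0
  then show ?case by auto
next
  case (Suc i)
  show ?case
  proof (cases "j = t x")
    case False
    obtain y where y: "(y, x) \<in> parcs G" "t x = t y + 1"
      using level_pred[of x] Suc by auto
    with False Suc in_arcsD1[OF y(1)] show ?thesis by auto
  qed (use Suc in auto)
qed

text \<open>Predecessors leave no gap below the largest level, so the indices of the intersection
  matrix are exactly the attained levels.\<close>

lemma level_image: "t ` pverts G = {..covering_radius G C}"
proof -
  have ne: "t ` pverts G \<noteq> {}" and fin: "finite (t ` pverts G)"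
    using code_subset code_nonempty pair_finite_verts by auto
  have "{i. layer G C i \<noteq> {}} = t ` pverts G" by (auto simp: layer_eq)
  then have cr: "covering_radius G C = Max (t ` pverts G)"
    by (simp add: covering_radius_def)
  then have "covering_radius G C \<in> t ` pverts G" using Max_in[OF fin ne] by simp
  then obtain x where x: "x \<in> pverts G" "t x = covering_radius G C" by auto
  show ?thesis
  proof
    show "t ` pverts G \<subseteq> {..covering_radius G C}" using fin cr by auto
    show "{..covering_radius G C} \<subseteq> t ` pverts G"
      using level_down[OF x(1)] x(2) by force
  qed
qed

lemma level_le_radius: "x \<in> pverts G \<Longrightarrow> t x \<le> covering_radius G C"
  using level_image by auto

lemma level_sym: "(x, y) \<in> parcs G \<Longrightarrow> (y, x) \<in> parcs G"
  using pair_sym_arcs by (auto simp: symmetric_def sym_def)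

lemma level_close:
  assumes "y \<in> nbrs G x"
  shows "t y \<le> t x + 1" "t x \<le> t y + 1"
  using assms level_step[of x y] level_step[of y x] level_sym[of x y] by (auto simp: nbrs_def)

definition equitable :: bool where
  "equitable \<longleftrightarrow> (\<exists>N. \<forall>x\<in>pverts G. \<forall>j. card {y \<in> nbrs G x. t y = j} = N (t x) j)"

lemma nbrs_layer: "nbrs G x \<inter> layer G C j = {y \<in> nbrs G x. t y = j}"
  using nbrs_subset by (auto simp: layer_eq)

text \<open>Levels of neighbours differ by at most one, so the three numbers in the definition
  account for all nonzero counts.\<close>

lemma completely_regular_iff:
  assumes "regular_graph G k"
  shows "completely_regular G C \<longleftrightarrow> equitable"
proof
  assume "completely_regular G C"
  then obtain \<alpha> \<beta> \<gamma> :: "nat \<Rightarrow> nat" where *: "\<forall>i\<le>covering_radius G C. \<forall>x\<in>layer G C i.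
        card (nbrs G x \<inter> layer G C i) = \<alpha> i \<and>
        card (nbrs G x \<inter> layer G C (i + 1)) = \<beta> i \<and>
        (i > 0 \<longrightarrow> card (nbrs G x \<inter> layer G C (i - 1)) = \<gamma> i)"
    unfolding completely_regular_def by blast
  define N where "N i j = (if j = i then \<alpha> i else if j = i + 1 then \<beta> i
      else if i = j + 1 then \<gamma> i else 0)" for i j
  have "card {y \<in> nbrs G x. t y = j} = N (t x) j" if x: "x \<in> pverts G" for x j
  proof -
    have **: "card {y \<in> nbrs G x. t y = t x} = \<alpha> (t x)"
      "card {y \<in> nbrs G x. t y = t x + 1} = \<beta> (t x)"
      "t x > 0 \<Longrightarrow> card {y \<in> nbrs G x. t y = t x - 1} = \<gamma> (t x)"
      using *[rule_format, of "t x" x] x level_le_radius[OF x] unfolding nbrs_layer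
      by (auto simp: layer_eq)
    consider "j = t x" | "j = t x + 1" | "t x = j + 1"
      | "j \<noteq> t x" "j \<noteq> t x + 1" "t x \<noteq> j + 1" by blast
    then show ?thesis
    proof cases
      case 4
      then have "{y \<in> nbrs G x. t y = j} = {}" using level_close[of _ x] by force
      then have "card {y \<in> nbrs G x. t y = j} = 0" by (simp only: card.empty)
      then show ?thesis using 4 by (simp add: N_def)
    qed (use ** in \<open>auto simp: N_def\<close>)
  qed
  then show equitable unfolding equitable_def by blast
next
  assume equitable
  then obtain N where N: "\<forall>x\<in>pverts G. \<forall>j. card {y \<in> nbrs G x. t y = j} = N (t x) j"
    unfolding equitable_def by blast
  show "completely_regular G C"
    unfolding completely_regular_def nbrs_layer
    using assms code_subset code_nonempty N
    by (intro conjI exI[of _ k] exI[of _ "\<lambda>i. N i i"] exI[of _ "\<lambda>i. N i (i + 1)"]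
        exI[of _ "\<lambda>i. N i (i - 1)"]) (auto simp: layer_eq)
qed

text \<open>A row of the intersection matrix applied to a vector is a sum over neighbours grouped by
  level. Eigenvectors thus become eigenfunctions of the graph that are constant on layers, the form
  in which they pass between the two graphs.\<close>

lemma Spec_iff:
  assumes equitable
  shows "\<theta> \<in> Spec G C \<longleftrightarrow> (\<exists>u. (\<exists>x\<in>pverts G. u (t x) \<noteq> 0) \<and>
    (\<forall>x\<in>pverts G. (\<Sum>y\<in>nbrs G x. u (t y)) = \<theta> * u (t x)))"
proof -
  let ?r = "covering_radius G C"
  let ?B = "intersection_mat G C"
  obtain N where N: "card {y \<in> nbrs G x. t y = j} = N (t x) j" if "x \<in> pverts G" for x j
    using assms unfolding equitable_def by blast
  \<comment> \<open>The vertex \<open>x\<close> itself lies in the layer, which makes the described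
    number unique.\<close>
  have int_num: "int_num G C (t x) j = N (t x) j" if "x \<in> pverts G" for x j
    unfolding int_num_def nbrs_layer using that N by (auto simp: layer_eq intro!: the_equality)
  have entry: "?B $$ (t x, j) = real (card {y \<in> nbrs G x. t y = j})"
    if x: "x \<in> pverts G" and j: "j \<le> ?r" for x j
  proof (cases "j = t x \<or> j = t x + 1 \<or> t x = j + 1")
    case True
    then show ?thesis
      using j level_le_radius[OF x] x by (simp add: intersection_mat_def int_num N)
  next
    case False
    then have "{y \<in> nbrs G x. t y = j} = {}" using level_close[of _ x] by force
    then have "card {y \<in> nbrs G x. t y = j} = 0" by (simp only: card.empty)
    then show ?thesis
      using False j level_le_radius[OF x] by (simp add: intersection_mat_def)
  qed
  have dim: "?B \<in> carrier_mat (?r + 1) (?r + 1)" by (simp add: intersection_mat_def)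
  have mult: "(?B *\<^sub>v v) $ t x = (\<Sum>y\<in>nbrs G x. v $ t y)"
    if x: "x \<in> pverts G" and v: "v \<in> carrier_vec (?r + 1)" for x v
  proof -
    have tx: "t x < ?r + 1" using level_le_radius[OF x] by simp
    have "(?B *\<^sub>v v) $ t x = (\<Sum>j\<in>{0..<?r + 1}. ?B $$ (t x, j) * v $ j)"
      using tx dim v by (simp add: scalar_prod_def)
    also have "\<dots> = (\<Sum>j\<le>?r. real (card {y \<in> nbrs G x. t y = j}) * v $ j)"
      using entry[OF x] by (intro sum.cong) auto
    also have "\<dots> = (\<Sum>y\<in>nbrs G x. v $ t y)"
      using nbrs_subset level_le_radius
      by (intro sum_by_value[symmetric]) (auto intro: finite_nbrs)
    finally show ?thesis .
  qed
  \<comment> \<open>Every index is the level of some vertex, so statements about entries become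
    statements about vertices.\<close>
  have levels: "(\<forall>i<?r + 1. P i) \<longleftrightarrow> (\<forall>x\<in>pverts G. P (t x))" for P
  proof -
    have "(\<forall>x\<in>pverts G. P (t x)) \<longleftrightarrow> (\<forall>i\<in>t ` pverts G. P i)" by blast
    then show ?thesis unfolding level_image by (auto simp: less_Suc_eq_le)
  qed
  have eig: "eigenvector ?B v \<theta> \<longleftrightarrow> (\<exists>x\<in>pverts G. v $ t x \<noteq> 0) \<and>
      (\<forall>x\<in>pverts G. (\<Sum>y\<in>nbrs G x. v $ t y) = \<theta> * v $ t x)"
    if v: "v \<in> carrier_vec (?r + 1)" for v
  proof -
    have "v = 0\<^sub>v (?r + 1) \<longleftrightarrow> (\<forall>i<?r + 1. v $ i = 0)"
      using v by (auto simp: vec_eq_iff)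
    moreover have "?B *\<^sub>v v = \<theta> \<cdot>\<^sub>v v \<longleftrightarrow> (\<forall>i<?r + 1. (?B *\<^sub>v v) $ i = \<theta> * v $ i)"
      using v dim by (auto simp: vec_eq_iff)
    ultimately show ?thesis
      using v dim unfolding eigenvector_def levels by (auto simp: mult)
  qed
  have "\<theta> \<in> Spec G C \<longleftrightarrow> (\<exists>v\<in>carrier_vec (?r + 1). eigenvector ?B v \<theta>)"
    using dim by (auto simp: Spec_def spectrum_def eigenvalue_def eigenvector_def)
  also have "\<dots> \<longleftrightarrow> (\<exists>u. (\<exists>x\<in>pverts G. u (t x) \<noteq> 0) \<and>
    (\<forall>x\<in>pverts G. (\<Sum>y\<in>nbrs G x. u (t y)) = \<theta> * u (t x)))" (is "_ \<longleftrightarrow> (\<exists>u. ?Q u)")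
  proof
    assume "\<exists>v\<in>carrier_vec (?r + 1). eigenvector ?B v \<theta>"
    then obtain v where "v \<in> carrier_vec (?r + 1)" "eigenvector ?B v \<theta>" by blast
    then have "?Q (\<lambda>i. v $ i)" using eig by blast
    then show "\<exists>u. ?Q u" by blast
  next
    assume "\<exists>u. ?Q u"
    then obtain u where u: "?Q u" by blast
    have v: "vec (?r + 1) u $ t x = u (t x)" if "x \<in> pverts G" for x
      using level_le_radius[OF that] by simp
    have "(\<Sum>y\<in>nbrs G x. vec (?r + 1) u $ t y) = (\<Sum>y\<in>nbrs G x. u (t y))" for x
      using nbrs_subset v by (intro sum.cong) blast+
    then have "eigenvector ?B (vec (?r + 1) u) \<theta>"
      using u v by (subst eig) auto
    then show "\<exists>v\<in>carrier_vec (?r + 1). eigenvector ?B v \<theta>" by (intro bexI) auto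
  qed
  finally show ?thesis .
qed

end

text \<open>The witness is the least length of a walk from \<open>C\<close>; such walks exist
  because a connected symmetric digraph is strongly connected.\<close>

lemma ex_distance_layering:
  assumes G: "pair_graph G" and conn: "Digraph_Component.connected (with_proj G)"
    and C: "C \<subseteq> pverts G" "C \<noteq> {}"
  shows "\<exists>t. distance_layering G C t"
proof -
  interpret pair_graph G by fact
  define W where "W x n \<longleftrightarrow> (\<exists>c\<in>C. \<exists>p. awalk c p x \<and> length p = n)" for x n
  define t where "t x = (LEAST n. W x n)" for x
  have sc: "strongly_connected (with_proj G)"
    using conn pair_sym_arcs by (intro symmetric_connected_imp_strongly_connected) simp_all
  have ex: "\<exists>n. W x n" if x: "x \<in> pverts G" for x
  proof -
    obtain c where c: "c \<in> C" using C by blast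
    then have "c \<in> pverts G" using C by blast
    then have "c \<rightarrow>\<^sup>*\<^bsub>with_proj G\<^esub> x" using sc x by (auto simp: strongly_connected_def)
    then obtain p where "awalk c p x" unfolding reachable_awalk by blast
    with c show ?thesis unfolding W_def by blast
  qed
  have W_t: "W x (t x)" if "x \<in> pverts G" for x
    unfolding t_def using ex[OF that] by (rule LeastI_ex)
  have t_le: "t x \<le> n" if "W x n" for x n
    unfolding t_def using that by (rule Least_le)
  have W_step: "W y (Suc n)" if Wx: "W x n" and xy: "(x, y) \<in> parcs G" for x y n
  proof -
    obtain c p where "c \<in> C" "awalk c p x" "length p = n" using Wx unfolding W_def by blast
    moreover have "awalk x [(x, y)] y"
      using xy by (auto simp: awalk_Cons_iff awalk_Nil_iff dest: in_arcsD1 in_arcsD2)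
    ultimately show ?thesis
      unfolding W_def by (intro bexI[of _ c] exI[of _ "p @ [(x, y)]"]) auto
  qed
  have W_zero: "W x 0 \<longleftrightarrow> x \<in> C" for x
    using C by (auto simp: W_def awalk_Nil_iff)
  have W_pred: "\<exists>x. (x, y) \<in> parcs G \<and> W x n" if y: "W y (Suc n)" for y n
  proof -
    obtain c p where c: "c \<in> C" "awalk c p y" "length p = Suc n" using y unfolding W_def by blast
    obtain q e where p: "p = q @ [e]" using c(3) by (metis length_Suc_conv_rev)
    obtain x where "awalk c q x" "awalk x [e] y" using c(2) unfolding p by auto
    then have "e = (x, y)" "e \<in> parcs G" by (auto simp: awalk_Cons_iff awalk_Nil_iff)
    with c p \<open>awalk c q x\<close> show ?thesis by (auto simp: W_def)
  qed
  have "distance_layering G C t"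
  proof unfold_locales
    fix x assume x: "x \<in> pverts G"
    show "t x = 0 \<longleftrightarrow> x \<in> C"
      using W_t[OF x] t_le[of x 0] W_zero[of x] by auto
    assume "t x > 0"
    then obtain n where n: "t x = Suc n" using gr0_implies_Suc by blast
    obtain y where y: "(y, x) \<in> parcs G" "W y n" using W_pred W_t[OF x] n by metis
    \<comment> \<open>A shortest walk to \<open>y\<close> extends to \<open>x\<close>, so
      \<open>t y\<close> is at least \<open>n\<close>; \<open>W y n\<close> gives the other
      bound.\<close>
    have "t x \<le> Suc (t y)" using t_le W_step W_t y in_arcsD1 by blast
    then show "\<exists>y. (y, x) \<in> parcs G \<and> t x = t y + 1"
      using y n t_le[of y n] by (intro exI[of _ y]) auto
  next
    fix x y assume xy: "(x, y) \<in> parcs G"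
    then show "t y \<le> t x + 1" using t_le W_step W_t in_arcsD1 by (metis Suc_eq_plus1)
  qed (use C in auto)
  then show ?thesis by blast
qed

text \<open>Factoring the whole function of \<open>j\<close> at once yields a single
  \<open>N\<close>.\<close>

lemma (in distance_layering) equitableI:
  assumes "\<And>x y j. x \<in> pverts G \<Longrightarrow> y \<in> pverts G \<Longrightarrow> t x = t y \<Longrightarrow>
    card {z \<in> nbrs G x. t z = j} = card {z \<in> nbrs G y. t z = j}"
  shows equitable
proof -
  have "\<exists>N. \<forall>x\<in>pverts G. (\<lambda>j. card {z \<in> nbrs G x. t z = j}) = N (t x)"
    by (rule factor_through) (use assms in blast)
  then show ?thesis unfolding equitable_def fun_eq_iff .
qed

subsection \<open>Graphs covered by cliques\<close>

locale clique_geometry = pair_graph G for G :: "'a pair_pre_digraph" +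
  fixes \<K> :: "'a set set" and n r :: nat
  assumes clique_K: "K \<in> \<K> \<Longrightarrow> clique G K"
    and card_K: "K \<in> \<K> \<Longrightarrow> card K = n"
    and n_ge_2: "n \<ge> 2"
    and edge_clique: "(x, y) \<in> parcs G \<Longrightarrow> \<exists>!K. K \<in> \<K> \<and> x \<in> K \<and> y \<in> K"
    and card_cliques_at: "x \<in> pverts G \<Longrightarrow> card {K \<in> \<K>. x \<in> K} = r"
    and r_pos: "r > 0"
begin

lemma K_subset: "K \<in> \<K> \<Longrightarrow> K \<subseteq> pverts G"
  using clique_K by (auto simp: clique_def)

lemma K_edge: "K \<in> \<K> \<Longrightarrow> x \<in> K \<Longrightarrow> y \<in> K \<Longrightarrow> x \<noteq> y \<Longrightarrow> (x, y) \<in> parcs G"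
  using clique_K by (auto simp: clique_def)

lemma finite_K: "K \<in> \<K> \<Longrightarrow> finite K"
  using K_subset pair_finite_verts finite_subset by blast

lemma finite_cliques: "finite \<K>"
proof (rule finite_subset)
  show "\<K> \<subseteq> Pow (pverts G)" using K_subset by blast
  show "finite (Pow (pverts G))" using pair_finite_verts by simp
qed

lemma K_nonempty: "K \<in> \<K> \<Longrightarrow> K \<noteq> {}"
  using card_K n_ge_2 by fastforce

text \<open>A second common vertex would form with \<open>x\<close> an edge lying in two
  cliques.\<close>

lemma K_inter:
  assumes "K \<in> \<K>" "L \<in> \<K>" "K \<noteq> L" "x \<in> K" "x \<in> L"
  shows "K \<inter> L = {x}"
proof -
  have "y = x" if "y \<in> K" "y \<in> L" for y
    using assms that edge_clique[of x y] K_edge[of K x y] by blast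
  with assms show ?thesis by blast
qed

lemma parcs_clique_graph:
  "(K, L) \<in> parcs (clique_graph \<K>) \<longleftrightarrow> K \<in> \<K> \<and> L \<in> \<K> \<and> K \<noteq> L \<and> K \<inter> L \<noteq> {}"
proof -
  have "card (K \<inter> L) = 1" if "K \<in> \<K>" "L \<in> \<K>" "K \<noteq> L" "x \<in> K" "x \<in> L" for x
    using K_inter[OF that] by simp
  then show ?thesis by (auto simp: clique_graph_def)
qed

lemma pverts_clique_graph [simp]: "pverts (clique_graph \<K>) = \<K>"
  by (simp add: clique_graph_def)

lemma nbrs_clique_graph:
  "K \<in> \<K> \<Longrightarrow> nbrs (clique_graph \<K>) K = {L \<in> \<K>. K \<noteq> L \<and> K \<inter> L \<noteq> {}}"
  by (auto simp: nbrs_def parcs_clique_graph)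

lemma pair_graph_clique_graph: "pair_graph (clique_graph \<K>)"
proof unfold_locales
  show "finite (pverts (clique_graph \<K>))" using finite_cliques by simp
  show "finite (parcs (clique_graph \<K>))"
    by (rule finite_subset[of _ "\<K> \<times> \<K>"]) (auto simp: finite_cliques parcs_clique_graph)
  show "symmetric (with_proj (clique_graph \<K>))"
    by (auto simp: symmetric_def sym_def parcs_clique_graph)
qed (auto simp: parcs_clique_graph)

text \<open>The next two lemmas are \<open>N N\<^sup>T = A + r I\<close> and \<open>N\<^sup>T N = A' + n I\<close>.\<close>

lemma sum_cliques_vertices:
  fixes h :: "'a \<Rightarrow> real"
  assumes x: "x \<in> pverts G"
  shows "(\<Sum>K | K \<in> \<K> \<and> x \<in> K. \<Sum>y\<in>K. h y) = (\<Sum>y\<in>nbrs G x. h y) + real r * h x"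
proof -
  let ?at = "{K \<in> \<K>. x \<in> K}"
  have "(\<Sum>K\<in>?at. \<Sum>y\<in>K. h y) = (\<Sum>K\<in>?at. (\<Sum>y\<in>K - {x}. h y) + h x)"
    by (intro sum.cong) (auto simp: finite_K sum.remove)
  also have "\<dots> = (\<Sum>K\<in>?at. \<Sum>y\<in>K - {x}. h y) + real r * h x"
    using card_cliques_at[OF x] by (simp add: sum.distrib)
  \<comment> \<open>Away from \<open>x\<close> the cliques through \<open>x\<close> are disjoint,
    and together they cover the neighbours of \<open>x\<close>.\<close>
  also have "(\<Sum>K\<in>?at. \<Sum>y\<in>K - {x}. h y) = (\<Sum>y\<in>(\<Union>K\<in>?at. K - {x}). h y)"
  proof (rule sum.UNION_disjoint[symmetric])
    show "\<forall>K\<in>?at. \<forall>L\<in>?at. K \<noteq> L \<longrightarrow> (K - {x}) \<inter> (L - {x}) = {}"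
      using K_inter by blast
  qed (auto simp: finite_cliques finite_K)
  also have "(\<Union>K\<in>?at. K - {x}) = nbrs G x"
  proof
    show "(\<Union>K\<in>?at. K - {x}) \<subseteq> nbrs G x" using K_edge by (auto simp: nbrs_def)
    show "nbrs G x \<subseteq> (\<Union>K\<in>?at. K - {x})"
    proof
      fix y assume "y \<in> nbrs G x"
      then have xy: "(x, y) \<in> parcs G" by (simp add: nbrs_def)
      then show "y \<in> (\<Union>K\<in>?at. K - {x})"
        using edge_clique[OF xy] pair_no_loops[OF xy] by auto
    qed
  qed
  finally show ?thesis .
qed

lemma sum_vertices_cliques:
  fixes f :: "'a set \<Rightarrow> real"
  assumes K: "K \<in> \<K>"
  shows "(\<Sum>x\<in>K. \<Sum>L | L \<in> \<K> \<and> x \<in> L. f L) =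
    (\<Sum>L\<in>nbrs (clique_graph \<K>) K. f L) + real n * f K"
proof -
  let ?at = "\<lambda>x. {L \<in> \<K>. x \<in> L}"
  have "(\<Sum>x\<in>K. \<Sum>L\<in>?at x. f L) = (\<Sum>x\<in>K. (\<Sum>L\<in>?at x - {K}. f L) + f K)"
    using K by (intro sum.cong) (auto simp: finite_cliques sum.remove)
  also have "\<dots> = (\<Sum>x\<in>K. \<Sum>L\<in>?at x - {K}. f L) + real n * f K"
    using card_K[OF K] by (simp add: sum.distrib)
  \<comment> \<open>A clique other than \<open>K\<close> meets \<open>K\<close> in at most one
    vertex, so it is counted only once.\<close>
  also have "(\<Sum>x\<in>K. \<Sum>L\<in>?at x - {K}. f L) = (\<Sum>L\<in>(\<Union>x\<in>K. ?at x - {K}). f L)"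
  proof (rule sum.UNION_disjoint[symmetric])
    show "\<forall>x\<in>K. \<forall>y\<in>K. x \<noteq> y \<longrightarrow> (?at x - {K}) \<inter> (?at y - {K}) = {}"
      using K_inter K by blast
  qed (auto simp: finite_cliques finite_K K)
  also have "(\<Union>x\<in>K. ?at x - {K}) = nbrs (clique_graph \<K>) K"
    using K by (auto simp: nbrs_clique_graph)
  finally show ?thesis .
qed

text \<open>Double counting of incident pairs: \<open>N\<close> and \<open>N\<^sup>T\<close> are
  adjoint.\<close>

lemma sum_flags:
  fixes g :: "'a \<Rightarrow> 'a set \<Rightarrow> real"
  shows "(\<Sum>x\<in>pverts G. \<Sum>K | K \<in> \<K> \<and> x \<in> K. g x K) = (\<Sum>K\<in>\<K>. \<Sum>x\<in>K. g x K)"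
proof -
  have "(\<Sum>x\<in>pverts G. \<Sum>K | K \<in> \<K> \<and> x \<in> K. g x K) =
      (\<Sum>K\<in>\<K>. \<Sum>x | x \<in> pverts G \<and> x \<in> K. g x K)"
    using pair_finite_verts finite_cliques by (rule sum.swap_restrict)
  also have "\<dots> = (\<Sum>K\<in>\<K>. \<Sum>x\<in>K. g x K)"
  proof (rule sum.cong)
    fix K assume "K \<in> \<K>"
    then have "{x. x \<in> pverts G \<and> x \<in> K} = K" using K_subset by blast
    then show "(\<Sum>x | x \<in> pverts G \<and> x \<in> K. g x K) = (\<Sum>x\<in>K. g x K)" by simp
  qed simp
  finally show ?thesis .
qed

text \<open>\<open>N\<^sup>T N\<close> sends the constant 1 to the constant \<open>n * r\<close>;
  removing the diagonal term \<open>n\<close> leaves the degree.\<close>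

lemma regular_clique_graph: "regular_graph (clique_graph \<K>) (n * r - n)"
proof -
  have "card (nbrs (clique_graph \<K>) K) = n * r - n" if K: "K \<in> \<K>" for K
  proof -
    have "(\<Sum>x\<in>K. \<Sum>L | L \<in> \<K> \<and> x \<in> L. 1::real) = (\<Sum>x\<in>K. real r)"
      using K_subset[OF K] card_cliques_at by (intro sum.cong) auto
    also have "\<dots> = real (n * r)" using card_K[OF K] by simp
    finally have "real (n * r) = real (card (nbrs (clique_graph \<K>) K) + n)"
      using sum_vertices_cliques[OF K, of "\<lambda>_. 1"] by simp
    then have "n * r = card (nbrs (clique_graph \<K>) K) + n" by (simp only: of_nat_eq_iff)
    then show ?thesis by simp
  qed
  then show ?thesis using pair_graph_clique_graph by (simp add: regular_graph_def)
qed

text \<open>The eigenvalue \<open>- r\<close> of \<open>A\<close> is the eigenvalue \<open>0\<close> of \<open>N N\<^sup>T\<close>, whose kernel is that of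
  \<open>N\<^sup>T\<close>; dually for \<open>- n\<close> and \<open>A'\<close>.\<close>

lemma clique_sum_zero:
  fixes h :: "'a \<Rightarrow> real"
  assumes h: "\<And>x. x \<in> pverts G \<Longrightarrow> (\<Sum>y\<in>nbrs G x. h y) = - real r * h x"
    and K: "K \<in> \<K>"
  shows "(\<Sum>x\<in>K. h x) = 0"
proof -
  \<comment> \<open>The squared norm of \<open>N\<^sup>T h\<close> is the inner product of
    \<open>h\<close> with \<open>N N\<^sup>T h\<close>, which is zero.\<close>
  have "(\<Sum>L\<in>\<K>. (\<Sum>x\<in>L. h x)\<^sup>2) = (\<Sum>L\<in>\<K>. \<Sum>x\<in>L. h x * (\<Sum>y\<in>L. h y))"
    by (simp add: power2_eq_square sum_distrib_right)
  also have "\<dots> = (\<Sum>x\<in>pverts G. h x * (\<Sum>L | L \<in> \<K> \<and> x \<in> L. \<Sum>y\<in>L. h y))"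
    by (simp add: sum_flags[symmetric] sum_distrib_left)
  also have "\<dots> = 0"
    by (intro sum.neutral ballI) (simp add: sum_cliques_vertices h)
  finally have "\<forall>L\<in>\<K>. (\<Sum>x\<in>L. h x)\<^sup>2 = 0"
    by (subst (asm) sum_nonneg_eq_0_iff) (auto simp: finite_cliques)
  with K show ?thesis by simp
qed

lemma vertex_sum_zero:
  fixes f :: "'a set \<Rightarrow> real"
  assumes f: "\<And>K. K \<in> \<K> \<Longrightarrow> (\<Sum>L\<in>nbrs (clique_graph \<K>) K. f L) = - real n * f K"
    and x: "x \<in> pverts G"
  shows "(\<Sum>K | K \<in> \<K> \<and> x \<in> K. f K) = 0"
proof -
  let ?s = "\<lambda>x. \<Sum>K | K \<in> \<K> \<and> x \<in> K. f K"
  have "(\<Sum>x\<in>pverts G. (?s x)\<^sup>2) = (\<Sum>x\<in>pverts G. \<Sum>K | K \<in> \<K> \<and> x \<in> K. f K * ?s x)"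
    by (simp add: power2_eq_square sum_distrib_right)
  also have "\<dots> = (\<Sum>K\<in>\<K>. f K * (\<Sum>x\<in>K. ?s x))"
    by (simp add: sum_flags sum_distrib_left)
  also have "\<dots> = 0"
    by (intro sum.neutral ballI) (simp add: sum_vertices_cliques f)
  finally have "\<forall>x\<in>pverts G. (?s x)\<^sup>2 = 0"
    by (subst (asm) sum_nonneg_eq_0_iff) (auto simp: pair_finite_verts)
  with x show ?thesis by simp
qed

end

section \<open>Cliques meet exactly two consecutive layers\<close>

locale geometric_code = distance_layering G C t + clique_geometry G \<K> n r
  for G :: "'a pair_pre_digraph" and C t \<K> n r +
  fixes u :: "nat \<Rightarrow> real"
  assumes equitable: equitable
    and clique_sum_u: "K \<in> \<K> \<Longrightarrow> (\<Sum>x\<in>K. u (t x)) = 0"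
    and u_nonzero_ex: "\<exists>x\<in>pverts G. u (t x) \<noteq> 0"
begin

text \<open>For a clique of \<open>\<K>\<close> this turns out to be the distance from
  \<open>C'\<close> in the clique graph.\<close>

definition T :: "'a set \<Rightarrow> nat" where
  "T K = Min (t ` K)"

abbreviation C' :: "'a set set" where
  "C' \<equiv> {K \<in> \<K>. K \<inter> C \<noteq> {}}"

text \<open>The clique on the edge meets both levels and no third one, since its levels differ
  pairwise by at most one. Its zero sum is therefore a combination of the two values with positive
  coefficients.\<close>

lemma u_zero_step:
  assumes xy: "(x, y) \<in> parcs G" and t: "t y = t x + 1"
  shows "u (t x) = 0 \<longleftrightarrow> u (t y) = 0"
proof -
  obtain K where K: "K \<in> \<K>" "x \<in> K" "y \<in> K" using edge_clique[OF xy] by blast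
  have le: "t a \<le> t b + 1" if "a \<in> K" "b \<in> K" for a b
    using level_step[of b a] K_edge[OF K(1) that(2,1)] by (cases "a = b") auto
  have "t ` K \<subseteq> {t x, t x + 1}"
  proof (rule image_subsetI)
    fix z assume "z \<in> K"
    then show "t z \<in> {t x, t x + 1}" using le[of z x] le[of y z] K t by auto
  qed
  then have "real (card {z \<in> K. t z = t x}) * u (t x)
      + real (card {z \<in> K. t z = t x + 1}) * u (t y) = 0"
    using sum_by_value[OF finite_K[OF K(1)], of "{t x, t x + 1}" t u] clique_sum_u[OF K(1)] t by simp
  moreover have "card {z \<in> K. t z = t x} \<noteq> 0" "card {z \<in> K. t z = t x + 1} \<noteq> 0"
    using K t finite_K[OF K(1)] by auto
  ultimately show ?thesis by auto
qed

lemma u_zero_iff: "x \<in> pverts G \<Longrightarrow> u (t x) = 0 \<longleftrightarrow> u 0 = 0"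
proof (induction "t x" arbitrary: x)
  case 0
  then show ?case by simp
next
  case (Suc i)
  obtain y where y: "(y, x) \<in> parcs G" "t x = t y + 1"
    using level_pred[of x] Suc by auto
  with Suc show ?case using u_zero_step[OF y] in_arcsD1[OF y(1)] by auto
qed

text \<open>A zero on one level would spread through level 0 to all levels.\<close>

lemma u_nonzero: "x \<in> pverts G \<Longrightarrow> u (t x) \<noteq> 0"
  using u_nonzero_ex u_zero_iff by blast

text \<open>A clique spans at most two levels; inside a single one its sum would be \<open>n\<close>
  times a nonzero value of \<open>u\<close>.\<close>

lemma clique_levels:
  assumes K: "K \<in> \<K>"
  shows "t ` K = {T K, T K + 1}"
proof -
  have fin: "finite (t ` K)" and ne: "t ` K \<noteq> {}"
    using finite_K[OF K] K_nonempty[OF K] by auto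
  have le: "t a \<le> t b + 1" if "a \<in> K" "b \<in> K" for a b
    using level_step[of b a] K_edge[OF K that(2,1)] by (cases "a = b") auto
  have T: "T K \<in> t ` K" unfolding T_def by (rule Min_in[OF fin ne])
  then obtain x where x: "x \<in> K" "t x = T K" by auto
  have ge: "T K \<le> t z" if "z \<in> K" for z
    unfolding T_def using fin that by simp
  have sub: "t ` K \<subseteq> {T K, T K + 1}"
  proof
    fix i assume "i \<in> t ` K"
    then show "i \<in> {T K, T K + 1}" using ge le[OF _ x(1)] x(2) by fastforce
  qed
  have "T K + 1 \<in> t ` K"
  proof (rule ccontr)
    assume "T K + 1 \<notin> t ` K"
    then have "t z \<noteq> T K + 1" if "z \<in> K" for z using that by force
    then have "t z = T K" if "z \<in> K" for z using sub that by force
    then have "(\<Sum>z\<in>K. u (t z)) = real n * u (t x)" using x card_K[OF K] by simp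
    moreover have "u (t x) \<noteq> 0" using u_nonzero x K_subset[OF K] by blast
    ultimately show False using clique_sum_u[OF K] n_ge_2 by simp
  qed
  with sub T show ?thesis by blast
qed

definition lower :: "'a set \<Rightarrow> nat" where
  "lower K = card {x \<in> K. t x = T K}"

definition upper :: "'a set \<Rightarrow> nat" where
  "upper K = card {x \<in> K. t x = T K + 1}"

lemma clique_sum:
  fixes \<phi> :: "nat \<Rightarrow> real"
  assumes "K \<in> \<K>"
  shows "(\<Sum>x\<in>K. \<phi> (t x)) = real (lower K) * \<phi> (T K) + real (upper K) * \<phi> (T K + 1)"
  using sum_by_value[OF finite_K[OF assms], of "{T K, T K + 1}" t \<phi>] clique_levels[OF assms]
  by (simp add: lower_def upper_def)

lemma upper_pos:
  assumes "K \<in> \<K>"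
  shows "upper K > 0"
proof -
  have "T K + 1 \<in> t ` K" using clique_levels[OF assms] by simp
  then obtain x where "x \<in> K" "t x = T K + 1" by auto
  then show ?thesis
    unfolding upper_def using finite_K[OF assms] by (auto simp: card_gt_0_iff)
qed

text \<open>With \<open>i = T K\<close>, both counts solve a linear system: their sum is
  \<open>n\<close>, and weighted by \<open>u i\<close> and \<open>u (i + 1)\<close> they add to
  zero. The system is regular, as \<open>u i = u (i + 1)\<close> would force
  \<open>n * u i = 0\<close>.\<close>

lemma lower_upper_cong:
  assumes K: "K \<in> \<K>" and L: "L \<in> \<K>" and eq: "T K = T L"
  shows "lower K = lower L" "upper K = upper L"
proof -
  let ?i = "T K"
  have n: "real (lower M) + real (upper M) = real n" if "M \<in> \<K>" for M
    using clique_sum[OF that, of "\<lambda>_. 1"] card_K[OF that] by simp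
  have 0: "real (lower M) * u ?i + real (upper M) * u (?i + 1) = 0"
    if "M \<in> \<K>" "T M = ?i" for M
    using clique_sum[OF that(1), of u] clique_sum_u[OF that(1)] that(2) by simp
  have "?i \<in> t ` K" using clique_levels[OF K] by simp
  then obtain x where "x \<in> K" "t x = ?i" by auto
  then have "u ?i \<noteq> 0" using u_nonzero[of x] K_subset[OF K] by auto
  have "u ?i \<noteq> u (?i + 1)"
  proof
    assume "u ?i = u (?i + 1)"
    then have "real n * u ?i = 0"
      using 0[OF K refl] n[OF K] by (simp add: distrib_right[symmetric])
    then show False using \<open>u ?i \<noteq> 0\<close> n_ge_2 by simp
  qed
  moreover have "(real (lower K) - real (lower L)) * (u ?i - u (?i + 1)) = 0"
  proof -
    have upper: "real (upper M) = real n - real (lower M)" if "M \<in> \<K>" for M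
      using n[OF that] by simp
    show ?thesis
      using 0[OF K refl] 0[OF L eq[symmetric]] unfolding upper[OF K] upper[OF L]
      by (simp add: algebra_simps)
  qed
  ultimately show "lower K = lower L" by simp
  then show "upper K = upper L" using n[OF K] n[OF L] by simp
qed

lemma T_in: "K \<in> \<K> \<Longrightarrow> x \<in> K \<Longrightarrow> t x = T K \<or> t x = T K + 1"
  using clique_levels by blast

lemma ex_level_T:
  assumes "K \<in> \<K>"
  obtains x where "x \<in> K" "t x = T K"
proof -
  have "T K \<in> t ` K" using clique_levels[OF assms] by simp
  then show ?thesis using that by auto
qed

text \<open>The nested comprehension matches the form of \<open>sum_by_value\<close> and
  \<open>sum_indicator_value\<close>.\<close>

definition cliques_at :: "'a \<Rightarrow> nat \<Rightarrow> nat" where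
  "cliques_at x j = card {K \<in> {K \<in> \<K>. x \<in> K}. T K = j}"

lemma cliques_at_sum:
  "(\<Sum>K | K \<in> \<K> \<and> x \<in> K. if T K = j then 1 else 0) = real (cliques_at x j)"
  unfolding cliques_at_def by (rule sum_indicator_value) (simp add: finite_cliques)

text \<open>Neighbours one level above \<open>x\<close> lie only in those cliques through
  \<open>x\<close> whose lower level is \<open>t x\<close>, and each such clique contains the same
  number of them.\<close>

lemma cliques_at_level_upper:
  assumes x: "x \<in> pverts G" and K: "K \<in> \<K>" "T K = t x"
  shows "real (cliques_at x (t x)) * real (upper K)
    = real (card {y \<in> nbrs G x. t y = t x + 1})"
proof -
  let ?\<phi> = "\<lambda>i. if i = t x + 1 then 1 else 0 :: real"
  have "real (cliques_at x (t x)) * real (upper K) =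
      (\<Sum>L | L \<in> \<K> \<and> x \<in> L. (if T L = t x then 1 else 0) * real (upper K))"
    unfolding cliques_at_sum[symmetric] by (simp only: sum_distrib_right)
  also have "\<dots> = (\<Sum>L | L \<in> \<K> \<and> x \<in> L. \<Sum>y\<in>L. ?\<phi> (t y))"
  proof (rule sum.cong)
    fix L assume L: "L \<in> {L. L \<in> \<K> \<and> x \<in> L}"
    then have sum: "(\<Sum>y\<in>L. ?\<phi> (t y)) = real (lower L) * ?\<phi> (T L) + real (upper L) * ?\<phi> (T L + 1)"
      by (intro clique_sum) simp
    consider "T L = t x" | "t x = T L + 1" using L T_in[of L x] by auto
    then show "(if T L = t x then 1 else 0) * real (upper K) = (\<Sum>y\<in>L. ?\<phi> (t y))"
    proof cases
      case 1
      then have "upper L = upper K" using L K lower_upper_cong(2)[of L K] by simp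
      with 1 show ?thesis unfolding sum by simp
    next
      case 2
      then show ?thesis unfolding sum by simp
    qed
  qed simp
  also have "\<dots> = real (card {y \<in> nbrs G x. t y = t x + 1})"
    by (simp add: sum_cliques_vertices[OF x] sum_indicator_value[OF finite_nbrs])
  finally show ?thesis .
qed

text \<open>Equitability fixes the number of neighbours one level up; dividing by the positive
  \<open>upper K\<close> fixes the cliques of type \<open>t x\<close>. The remaining ones among the
  \<open>r\<close> cliques have type \<open>t x - 1\<close>.\<close>

lemma cliques_at_cong:
  assumes x: "x \<in> pverts G" and y: "y \<in> pverts G" and eq: "t x = t y"
  shows "cliques_at x j = cliques_at y j"
proof -
  have same: "cliques_at x (t x) = cliques_at y (t x)"
  proof (cases "\<exists>K\<in>\<K>. T K = t x")
    case True
    then obtain K where K: "K \<in> \<K>" "T K = t x" by blast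
    have "card {z \<in> nbrs G x. t z = t x + 1} = card {z \<in> nbrs G y. t z = t x + 1}"
      using equitable x y eq unfolding equitable_def by fastforce
    then have "real (cliques_at x (t x)) * real (upper K)
        = real (cliques_at y (t x)) * real (upper K)"
      using cliques_at_level_upper[OF x K] cliques_at_level_upper[OF y, of K] K eq by simp
    then show ?thesis using upper_pos[OF K(1)] by simp
  next
    \<comment> \<open>This is the situation at the last level, where no clique can reach one level
      higher; both counts are zero.\<close>
    case False
    then have "{K \<in> {K \<in> \<K>. z \<in> K}. T K = t x} = {}" for z by blast
    then show ?thesis unfolding cliques_at_def by (simp only:)
  qed
  have zero: "cliques_at z i = 0" if "i \<noteq> t z" "i + 1 \<noteq> t z" for z i
  proof -
    have "{K \<in> {K \<in> \<K>. z \<in> K}. T K = i} = {}" using that T_in[of _ z] by force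
    then show ?thesis unfolding cliques_at_def by (simp only: card.empty)
  qed
  have below: "cliques_at z i + cliques_at z (i + 1) = r"
    if z: "z \<in> pverts G" "t z = i + 1" for z i
  proof -
    have at: "T K = i \<or> T K = i + 1" if "K \<in> \<K>" "z \<in> K" for K
      using T_in[OF that] z by auto
    have "{K \<in> \<K>. z \<in> K} = {K \<in> {K \<in> \<K>. z \<in> K}. T K = i}
        \<union> {K \<in> {K \<in> \<K>. z \<in> K}. T K = i + 1}" using at by blast
    then have "r = card ({K \<in> {K \<in> \<K>. z \<in> K}. T K = i}
        \<union> {K \<in> {K \<in> \<K>. z \<in> K}. T K = i + 1})" using card_cliques_at[OF z(1)] by (simp only:)
    also have "\<dots> = cliques_at z i + cliques_at z (i + 1)"
      unfolding cliques_at_def by (rule card_Un_disjoint) (auto simp: finite_cliques)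
    finally show ?thesis by simp
  qed
  consider "j = t x" | "t x = j + 1" | "j \<noteq> t x" "j + 1 \<noteq> t x" by fastforce
  then show ?thesis
  proof cases
    case 2
    then show ?thesis using below[OF x, of j] below[OF y, of j] same eq by simp
  qed (use same zero eq in auto)
qed

section \<open>The code in the clique graph\<close>

lemma T_zero: "K \<in> \<K> \<Longrightarrow> T K = 0 \<longleftrightarrow> K \<inter> C \<noteq> {}"
proof -
  assume K: "K \<in> \<K>"
  have *: "x \<in> K \<Longrightarrow> t x = 0 \<longleftrightarrow> x \<in> C" for x using K_subset[OF K] level_zero by blast
  have "T K = 0 \<longleftrightarrow> 0 \<in> t ` K" using clique_levels[OF K] by auto
  also have "\<dots> \<longleftrightarrow> K \<inter> C \<noteq> {}" using * by (force simp: image_iff)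
  finally show ?thesis .
qed

text \<open>A common vertex of two cliques has a level met by both, so \<open>T\<close> changes by
  at most one. For a predecessor of \<open>K\<close>, step down from a vertex of \<open>K\<close> on
  its lower level and take the clique on that edge.\<close>

lemma distance_layering_clique_graph: "distance_layering (clique_graph \<K>) C' T"
proof -
  interpret D: pair_graph "clique_graph \<K>" by (rule pair_graph_clique_graph)
  show ?thesis
  proof unfold_locales
    obtain x where x: "x \<in> C" "x \<in> pverts G" using code_nonempty code_subset by blast
    have "card {K \<in> \<K>. x \<in> K} > 0" using card_cliques_at[OF x(2)] r_pos by simp
    then have "{K \<in> \<K>. x \<in> K} \<noteq> {}" unfolding card_gt_0_iff by (rule conjunct1)
    then show "C' \<noteq> {}" using x by blast
  next
    fix K L assume "(K, L) \<in> parcs (clique_graph \<K>)"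
    then obtain x where "K \<in> \<K>" "L \<in> \<K>" "x \<in> K" "x \<in> L" by (auto simp: parcs_clique_graph)
    then show "T L \<le> T K + 1" using T_in[of K x] T_in[of L x] by auto
  next
    fix K assume "K \<in> pverts (clique_graph \<K>)" and pos: "T K > 0"
    then have K: "K \<in> \<K>" by simp
    obtain x where x: "x \<in> K" "t x = T K" using ex_level_T[OF K] .
    then obtain y where y: "(y, x) \<in> parcs G" "t x = t y + 1"
      using level_pred[of x] K_subset[OF K] pos by auto
    obtain L where L: "L \<in> \<K>" "y \<in> L" "x \<in> L" using edge_clique[OF y(1)] by blast
    have "T K = T L + 1" using T_in[OF L(1,2)] T_in[OF L(1,3)] x y by auto
    with K L x show "\<exists>L. (L, K) \<in> parcs (clique_graph \<K>) \<and> T K = T L + 1"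
      by (intro exI[of _ L]) (auto simp: parcs_clique_graph)
  qed (use T_zero in auto)
qed

sublocale CG: distance_layering "clique_graph \<K>" C' T
  by (rule distance_layering_clique_graph)

text \<open>Apply \<open>N\<^sup>T N = A' + n I\<close> to the indicator of type \<open>j\<close>.
  Its image under \<open>N\<close> is \<open>cliques_at\<close>, a function of the level, and the
  sum of that over a clique depends only on the type of the clique.\<close>

lemma equitable_clique_graph: "CG.equitable"
proof (rule CG.equitableI)
  fix K L j assume "K \<in> pverts (clique_graph \<K>)" "L \<in> pverts (clique_graph \<K>)" and eq: "T K = T L"
  then have K: "K \<in> \<K>" and L: "L \<in> \<K>" by auto
  have "\<exists>\<phi>. \<forall>x\<in>pverts G. real (cliques_at x j) = \<phi> (t x)"
    by (rule factor_through) (auto intro: cliques_at_cong)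
  then obtain \<phi> where \<phi>: "\<And>x. x \<in> pverts G \<Longrightarrow> real (cliques_at x j) = \<phi> (t x)"
    by blast
  have *: "real (card {M \<in> nbrs (clique_graph \<K>) M'. T M = j}) + real n * (if T M' = j then 1 else 0)
      = real (lower M') * \<phi> (T M') + real (upper M') * \<phi> (T M' + 1)" if M': "M' \<in> \<K>" for M'
  proof -
    have "(\<Sum>x\<in>M'. \<Sum>M | M \<in> \<K> \<and> x \<in> M. if T M = j then 1 else 0) = (\<Sum>x\<in>M'. \<phi> (t x))"
      using \<phi> K_subset[OF M'] by (intro sum.cong) (auto simp: cliques_at_sum)
    then show ?thesis
      by (simp only: sum_vertices_cliques[OF M'] clique_sum[OF M'] sum_indicator_value[OF CG.finite_nbrs])
  qed
  show "card {M \<in> nbrs (clique_graph \<K>) K. T M = j} = card {M \<in> nbrs (clique_graph \<K>) L. T M = j}"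
    using *[OF K] *[OF L] lower_upper_cong[OF K L eq] eq by simp
qed

lemma completely_regular_clique_graph: "completely_regular (clique_graph \<K>) C'"
  using CG.completely_regular_iff[OF regular_clique_graph] equitable_clique_graph by blast

section \<open>Transfer of eigenvalues between the two graphs\<close>

text \<open>The eigenfunction is \<open>f = N\<^sup>T v\<close>, so
  \<open>N\<^sup>T N f = (\<theta> + r) f\<close>. It is nonzero because
  \<open>N f = (\<theta> + r) v\<close>, where the factor is nonzero.\<close>

lemma Spec_clique_graphI:
  assumes \<theta>: "\<theta> \<in> Spec G C" and ne: "\<theta> \<noteq> - real r"
  shows "\<theta> + real r - real n \<in> Spec (clique_graph \<K>) C'"
proof -
  obtain v where nz: "\<exists>x\<in>pverts G. v (t x) \<noteq> 0"
    and v: "\<And>x. x \<in> pverts G \<Longrightarrow> (\<Sum>y\<in>nbrs G x. v (t y)) = \<theta> * v (t x)"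
    using \<theta> unfolding Spec_iff[OF equitable] by blast
  define f where "f K = (\<Sum>x\<in>K. v (t x))" for K
  have f_cong: "f K = f L" if "K \<in> \<K>" "L \<in> \<K>" "T K = T L" for K L
    using lower_upper_cong[OF that] that by (simp add: f_def clique_sum)
  have "\<exists>w. \<forall>K\<in>\<K>. f K = w (T K)" using f_cong by (rule factor_through)
  then obtain w where fw: "\<And>K. K \<in> \<K> \<Longrightarrow> f K = w (T K)" by blast
  have at: "(\<Sum>K | K \<in> \<K> \<and> x \<in> K. f K) = (\<theta> + real r) * v (t x)" if "x \<in> pverts G" for x
    unfolding f_def using sum_cliques_vertices[OF that] v[OF that] by (simp add: distrib_right)
  have "(\<Sum>L\<in>nbrs (clique_graph \<K>) K. w (T L)) = (\<theta> + real r - real n) * w (T K)"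
    if K: "K \<in> \<K>" for K
  proof -
    have "(\<Sum>L\<in>nbrs (clique_graph \<K>) K. w (T L)) = (\<Sum>L\<in>nbrs (clique_graph \<K>) K. f L)"
      using CG.nbrs_subset[of K] by (intro sum.cong refl fw[symmetric]) auto
    also have "\<dots> = (\<Sum>x\<in>K. \<Sum>L | L \<in> \<K> \<and> x \<in> L. f L) - real n * f K"
      by (simp add: sum_vertices_cliques[OF K])
    also have "(\<Sum>x\<in>K. \<Sum>L | L \<in> \<K> \<and> x \<in> L. f L) = (\<Sum>x\<in>K. (\<theta> + real r) * v (t x))"
      using K_subset[OF K] at by (intro sum.cong) auto
    also have "\<dots> = (\<theta> + real r) * f K" by (simp add: f_def sum_distrib_left)
    finally show ?thesis using fw[OF K] by (simp add: algebra_simps)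
  qed
  moreover have "\<exists>K\<in>\<K>. w (T K) \<noteq> 0"
  proof (rule ccontr)
    assume "\<not> ?thesis"
    then have "f K = 0" if "K \<in> \<K>" for K using fw that by simp
    then have "(\<theta> + real r) * v (t x) = 0" if "x \<in> pverts G" for x
      using at[OF that] by simp
    then show False using nz ne by auto
  qed
  ultimately show ?thesis
    unfolding CG.Spec_iff[OF equitable_clique_graph] pverts_clique_graph by blast
qed

text \<open>The eigenfunction is \<open>g = N w\<close>, which must be shown nonzero. The value
  \<open>- n\<close> is excluded since it would put \<open>w\<close> in the kernel of
  \<open>N\<close>; in terms of \<theta> = \<eta> + n - r this says \<theta> \<noteq> -r.\<close>

lemma Spec_clique_graphD:
  assumes \<eta>: "\<eta> \<in> Spec (clique_graph \<K>) C'"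
  shows "\<eta> + real n - real r \<in> Spec G C" "\<eta> \<noteq> - real n"
proof -
  obtain w where nz: "\<exists>K\<in>\<K>. w (T K) \<noteq> 0"
    and w: "\<And>K. K \<in> \<K> \<Longrightarrow> (\<Sum>L\<in>nbrs (clique_graph \<K>) K. w (T L)) = \<eta> * w (T K)"
    using \<eta> unfolding CG.Spec_iff[OF equitable_clique_graph] pverts_clique_graph by blast
  define g where "g x = (\<Sum>K | K \<in> \<K> \<and> x \<in> K. w (T K))" for x
  have g: "g x = (\<Sum>j\<in>T ` \<K>. real (cliques_at x j) * w j)" for x
    unfolding g_def cliques_at_def
    by (rule sum_by_value) (auto simp: finite_cliques)
  have g_cong: "g x = g y" if "x \<in> pverts G" "y \<in> pverts G" "t x = t y" for x y
    unfolding g using cliques_at_cong[OF that] by simp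
  have "\<exists>v. \<forall>x\<in>pverts G. g x = v (t x)" using g_cong by (rule factor_through)
  then obtain v where gv: "\<And>x. x \<in> pverts G \<Longrightarrow> g x = v (t x)" by blast
  have on_K: "(\<Sum>x\<in>K. g x) = (\<eta> + real n) * w (T K)" if "K \<in> \<K>" for K
    unfolding g_def using sum_vertices_cliques[OF that, of "\<lambda>L. w (T L)"] w[OF that]
    by (simp add: distrib_right)
  have eig: "(\<Sum>y\<in>nbrs G x. v (t y)) = (\<eta> + real n - real r) * v (t x)"
    if x: "x \<in> pverts G" for x
  proof -
    have "(\<Sum>y\<in>nbrs G x. v (t y)) = (\<Sum>y\<in>nbrs G x. g y)"
      using nbrs_subset[of x] by (intro sum.cong refl gv[symmetric]) auto
    also have "\<dots> = (\<Sum>K | K \<in> \<K> \<and> x \<in> K. \<Sum>y\<in>K. g y) - real r * g x"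
      by (simp add: sum_cliques_vertices[OF x])
    also have "(\<Sum>K | K \<in> \<K> \<and> x \<in> K. \<Sum>y\<in>K. g y) =
        (\<Sum>K | K \<in> \<K> \<and> x \<in> K. (\<eta> + real n) * w (T K))"
      using on_K by (intro sum.cong) auto
    also have "\<dots> = (\<eta> + real n) * g x" by (simp add: g_def sum_distrib_left)
    finally show ?thesis using gv[OF x] by (simp add: algebra_simps)
  qed
  \<comment> \<open>On functions of the type, \<open>N\<close> is triangular: a vertex on the lower
    level of \<open>K\<close> sees only the type of \<open>K\<close> and the one below, with
    positive coefficient at the former.\<close>
  have g_nz: "\<exists>x\<in>pverts G. g x \<noteq> 0"
  proof (rule ccontr)
    assume "\<not> ?thesis"
    then have g0: "g x = 0" if "x \<in> pverts G" for x using that by blast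
    have "w (T K) = 0" if "K \<in> \<K>" for K
      using that
    proof (induction "T K" arbitrary: K rule: less_induct)
      case less
      obtain x where x: "x \<in> K" "t x = T K" using ex_level_T[OF less.prems] .
      let ?at = "{L \<in> \<K>. x \<in> L}"
      \<comment> \<open>The other cliques through \<open>x\<close> have type \<open>T K\<close> or \<open>T K - 1\<close>.\<close>
      have "w (T L) = (if T L = T K then 1 else 0) * w (T K)" if "L \<in> ?at" for L
        using that less.hyps[of L] T_in[of L x] x by auto
      then have "g x = (\<Sum>L\<in>?at. (if T L = T K then 1 else 0) * w (T K))"
        unfolding g_def by (intro sum.cong) auto
      also have "\<dots> = real (cliques_at x (T K)) * w (T K)"
        unfolding cliques_at_sum[symmetric] by (simp only: sum_distrib_right)
      finally have "real (cliques_at x (T K)) * w (T K) = 0"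
        using g0[of x] x K_subset[OF less.prems] by auto
      moreover have "cliques_at x (T K) > 0"
        unfolding cliques_at_def using less.prems x by (auto simp: card_gt_0_iff finite_cliques)
      ultimately show ?case by simp
    qed
    then show False using nz by blast
  qed
  then show "\<eta> + real n - real r \<in> Spec G C"
    unfolding Spec_iff[OF equitable] using eig gv by (intro exI[of _ v]) auto
  show "\<eta> \<noteq> - real n"
  proof
    assume "\<eta> = - real n"
    then have "g x = 0" if "x \<in> pverts G" for x
      unfolding g_def using w that by (intro vertex_sum_zero) auto
    with g_nz show False by blast
  qed
qed

end

section \<open>Parameters of the geometry and the final correspondence\<close>

theorem theorem4:
  fixes G :: "'a pair_pre_digraph" and k :: nat and \<theta>\<^sub>d :: real
    and \<K> :: "'a set set" and C :: "'a set"
  assumes "distance_regular G"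
    and "regular_graph G k"
    and "\<theta>\<^sub>d = min_eigenvalue G"
    and "\<theta>\<^sub>d \<noteq> 0"
    and "geometric G k \<K>"
    and "completely_regular G C"
    and "\<theta>\<^sub>d \<in> Spec G C"
  shows "completely_regular (clique_graph \<K>) {K \<in> \<K>. K \<inter> C \<noteq> {}} \<and>
    Spec (clique_graph \<K>) {K \<in> \<K>. K \<inter> C \<noteq> {}} =
      {\<theta> - \<theta>\<^sub>d - 1 + real k / \<theta>\<^sub>d | \<theta>. \<theta> \<in> Spec G C \<and> \<theta> \<noteq> \<theta>\<^sub>d}"
proof -
  define \<rho> where "\<rho> = - real k / \<theta>\<^sub>d"
  have G: "pair_graph G" using assms(2) by (simp add: regular_graph_def)
  interpret pair_graph G by (rule G)
  have conn: "Digraph_Component.connected (with_proj G)"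
    using assms(1) by (simp add: distance_regular_def)
  have C: "C \<subseteq> pverts G" "C \<noteq> {}" using assms(6) by (auto simp: completely_regular_def)
  obtain t where "distance_layering G C t" using ex_distance_layering[OF G conn C] by blast
  then interpret distance_layering G C t .
  have eq: equitable using completely_regular_iff[OF assms(2)] assms(6) by blast
  obtain u where u_nz: "\<exists>x\<in>pverts G. u (t x) \<noteq> 0"
    and u: "\<And>x. x \<in> pverts G \<Longrightarrow> (\<Sum>y\<in>nbrs G x. u (t y)) = \<theta>\<^sub>d * u (t x)"
    using assms(7) unfolding Spec_iff[OF eq] by blast
  have deg: "card (nbrs G x) = k" if "x \<in> pverts G" for x
    using assms(2) that by (simp add: regular_graph_def)
  \<comment> \<open>Without edges the eigenvalue equation reads
    \<open>\<theta>\<^sub>d * u (t x) = 0\<close>, contradicting the nonzero eigenvalue.\<close>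
  have k: "k > 0"
  proof (rule ccontr)
    assume "\<not> k > 0"
    then have "nbrs G x = {}" if "x \<in> pverts G" for x
      using deg[OF that] finite_nbrs by simp
    then show False using u u_nz assms(4) by fastforce
  qed
  have clique: "clique G K" and card: "real (card K) = 1 + \<rho>" if "K \<in> \<K>" for K
    using assms(3,5) that by (auto simp: geometric_def delsarte_clique_def \<rho>_def)
  have edge: "\<exists>!K. K \<in> \<K> \<and> x \<in> K \<and> y \<in> K" if "(x, y) \<in> parcs G" for x y
    using assms(5) that unfolding geometric_def by (elim conjE) (drule (1) bspec, simp only: prod.case)
  have finK: "finite K" if "K \<in> \<K>" for K
    using clique[OF that] pair_finite_verts by (auto simp: clique_def intro: finite_subset)
  have finKK: "finite \<K>"
    by (rule finite_subset[of _ "Pow (pverts G)"])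
      (use clique pair_finite_verts in \<open>auto simp: clique_def\<close>)
  obtain x0 where x0: "x0 \<in> pverts G" using C by blast
  have "nbrs G x0 \<noteq> {}" using deg[OF x0] k by auto
  then obtain y0 where y0: "(x0, y0) \<in> parcs G" by (auto simp: nbrs_def)
  then obtain K0 where K0: "K0 \<in> \<K>" "x0 \<in> K0" "y0 \<in> K0" using edge by blast
  define n where "n = card K0"
  have n: "real n = 1 + \<rho>" using card[OF K0(1)] by (simp add: n_def)
  have card_n: "card K = n" if "K \<in> \<K>" for K
    using card[OF that] n by simp
  have "card {x0, y0} \<le> card K0" using K0 finK by (intro card_mono) auto
  moreover have "x0 \<noteq> y0" using pair_no_loops[OF y0] by simp
  ultimately have n2: "n \<ge> 2" by (simp add: n_def)
  have \<rho>_pos: "\<rho> > 0" using n n2 by simp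
  \<comment> \<open>The \<open>k\<close> neighbours of \<open>x\<close> split into cliques without
    \<open>x\<close>, each of size \<open>n - 1 = - k / \<theta>\<^sub>d\<close>; cancelling
    \<open>k\<close> gives the number of cliques and shows that \<open>- \<theta>\<^sub>d\<close> is
    a natural number.\<close>
  have at: "real (card {K \<in> \<K>. x \<in> K}) = - \<theta>\<^sub>d" if x: "x \<in> pverts G" for x
  proof -
    let ?at = "{K \<in> \<K>. x \<in> K}"
    have "nbrs G x = (\<Union>K\<in>?at. K - {x})"
    proof
      show "nbrs G x \<subseteq> (\<Union>K\<in>?at. K - {x})"
      proof
        fix y assume "y \<in> nbrs G x"
        then have xy: "(x, y) \<in> parcs G" by (simp add: nbrs_def)
        then show "y \<in> (\<Union>K\<in>?at. K - {x})"
          using edge[OF xy] pair_no_loops[OF xy] by auto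
      qed
      show "(\<Union>K\<in>?at. K - {x}) \<subseteq> nbrs G x" using clique by (auto simp: nbrs_def clique_def)
    qed
    moreover have "card (\<Union>K\<in>?at. K - {x}) = (\<Sum>K\<in>?at. card (K - {x}))"
    proof (rule card_UN_disjoint)
      show "\<forall>K\<in>?at. \<forall>L\<in>?at. K \<noteq> L \<longrightarrow> (K - {x}) \<inter> (L - {x}) = {}"
        using clique edge unfolding clique_def by blast
    qed (auto simp: finKK finK)
    moreover have "(\<Sum>K\<in>?at. card (K - {x})) = card ?at * (n - 1)"
      using card_n by simp
    ultimately have "k = card ?at * (n - 1)" using deg[OF x] by simp
    then have "real k = real (card ?at) * \<rho>" using n n2 by (simp add: of_nat_diff)
    then have "real k * (real (card ?at) + \<theta>\<^sub>d) = 0"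
      using assms(4) by (simp add: \<rho>_def field_simps)
    then show ?thesis using k by simp
  qed
  define r where "r = card {K \<in> \<K>. x0 \<in> K}"
  have r: "\<theta>\<^sub>d = - real r" using at[OF x0] by (simp add: r_def)
  interpret clique_geometry G \<K> n r
  proof unfold_locales
    show "card {K \<in> \<K>. x \<in> K} = r" if "x \<in> pverts G" for x
      using at[OF that] r by simp
    show "r > 0" using r assms(4) by simp
  qed (use clique card_n n2 edge in auto)
  interpret geometric_code G C t \<K> n r u
  proof unfold_locales
    show "(\<Sum>x\<in>K. u (t x)) = 0" if "K \<in> \<K>" for K
      using u r that by (intro clique_sum_zero) auto
  qed (use eq u_nz in auto)
  \<comment> \<open>Here \<open>- \<theta>\<^sub>d = r\<close> and
    \<open>k / \<theta>\<^sub>d = 1 - n\<close>.\<close>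
  have shift: "\<theta> - \<theta>\<^sub>d - 1 + real k / \<theta>\<^sub>d = \<theta> + real r - real n" for \<theta>
    using n r by (simp add: \<rho>_def)
  have "Spec (clique_graph \<K>) C' = {\<theta> + real r - real n | \<theta>. \<theta> \<in> Spec G C \<and> \<theta> \<noteq> - real r}"
  proof safe
    fix \<eta> assume \<eta>: "\<eta> \<in> Spec (clique_graph \<K>) C'"
    show "\<exists>\<theta>. \<eta> = \<theta> + real r - real n \<and> \<theta> \<in> Spec G C \<and> \<theta> \<noteq> - real r"
      using Spec_clique_graphD[OF \<eta>] by (intro exI[of _ "\<eta> + real n - real r"]) auto
  qed (use Spec_clique_graphI in auto)
  then show ?thesis
    unfolding shift using completely_regular_clique_graph r by simp
qed

end
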